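(* For every $1\neq w\in F_2$, every integer $n\geq32\ell(w)$ and every prime $p$, $$\tau_{w,\mathrm{GL}_n(\mathbb{F}_p)}(e)\leq|\mathrm{GL}_n(\mathbb{F}_p)|^{-\frac{1}{11\ell(w)}}.$$
   Context: $F_2$ is the free group on $x,y$; $\ell(w)$ is the length of the reduced word $w$. For a finite group $G$, $w_G:G^2\to G$ is evaluation and $\tau_{w,G}(g)=|w_G^{-1}(g)|/|G|^2$ is the word measure (pushforward of the uniform measure on $G^2$). *)

theory Defs
  imports "HOL-Algebra.Group" "Jordan_Normal_Form.Determinant"
begin

text \<open>Elements of the free group F_2 on x, y are represented by reduced words:
 lists of letters (generator, inverted?) with no letter adjacent to its inverse.\<close>

datatype gen2 = GX | GY

type_synonym word2 = "(gen2 \<times> bool) list"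

fun reduced :: "word2 \<Rightarrow> bool" where
  "reduced [] = True"
| "reduced [_] = True"
| "reduced ((a, s) # (b, t) # rest) = (\<not> (a = b \<and> s \<noteq> t) \<and> reduced ((b, t) # rest))"

text \<open>length of the reduced word = ell(w); the identity of F_2 is the empty word\<close>

definition letter_eval :: "('g, 'b) monoid_scheme \<Rightarrow> 'g \<Rightarrow> 'g \<Rightarrow> gen2 \<times> bool \<Rightarrow> 'g" where
  "letter_eval G g h l =
     (let v = (case fst l of GX \<Rightarrow> g | GY \<Rightarrow> h) in if snd l then inv\<^bsub>G\<^esub> v else v)"

definition word_eval :: "('g, 'b) monoid_scheme \<Rightarrow> word2 \<Rightarrow> 'g \<Rightarrow> 'g \<Rightarrow> 'g" where
  "word_eval G w g h = foldr (\<lambda>l acc. letter_eval G g h l \<otimes>\<^bsub>G\<^esub> acc) w \<one>\<^bsub>G\<^esub>"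

definition word_measure :: "word2 \<Rightarrow> ('g, 'b) monoid_scheme \<Rightarrow> 'g \<Rightarrow> real" where
  "word_measure w G a =
     real (card {(g, h). g \<in> carrier G \<and> h \<in> carrier G \<and> word_eval G w g h = a})
     / real (card (carrier G)) ^ 2"

definition GL :: "nat \<Rightarrow> ('k::field) mat monoid" where
  "GL n = \<lparr> carrier = {A \<in> carrier_mat n n. det A \<noteq> 0}, mult = (*), one = 1\<^sub>m n \<rparr>"

end

theory Submission
  imports Defs "HOL-Library.Cardinality"
begin

text \<open>Choose \<open>g, h\<close> uniformly and reveal them only along the orbit of a vector \<open>x\<close> under
  the successive letters of \<open>w\<close>, where \<open>x\<close> lies outside the span of everything known.  As
  \<open>w\<close> is reduced, the next image is uniform outside a known subspace, unless some earlier image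
  already fell into the span of the known vectors; and \<open>w(g, h) x = x\<close> forces such a coincidence.
  If at most \<open>d\<close> vectors are known, a coincidence has probability at most
  \<open>\<ell>(w) q^d / (q^n - q^d)\<close>, which is at most \<open>q^(-n/2)\<close> as long as \<open>d + \<ell>(w) \<le> n/2\<close>.  Each
  orbit costs at most \<open>\<ell>(w) + 1\<close> dimensions, so about \<open>n / (4 \<ell>(w))\<close> orbits can be revealed one
  after another, which gives the exponent \<open>-n^2 / (8 \<ell>(w))\<close> up to rounding.\<close>

section \<open>Reduced words, and the abstract action in which the argument runs\<close>

definition inv_letter :: "gen2 \<times> bool \<Rightarrow> gen2 \<times> bool" where
  "inv_letter l = (fst l, \<not> snd l)"

lemma inv_letter_inv_letter [simp]: "inv_letter (inv_letter l) = l"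
  by (simp add: inv_letter_def)

text \<open>Needed so that the letter applied next is not the inverse of the one just revealed,
  whose value at the current point would already be prescribed.\<close>

lemma reduced_appendD: "reduced (us @ l # m # vs) \<Longrightarrow> m \<noteq> inv_letter l"
proof (induction us rule: reduced.induct)
  case 1
  then show ?case by (cases l; cases m; auto simp: inv_letter_def)
next
  case (2 a)
  then show ?case by (cases a; cases l; cases m; auto simp: inv_letter_def)
next
  case (3 a s b t rest)
  then show ?case by simp
qed

text \<open>An abstraction of GL_n(F_q) on F_q^n, with \<open>cl\<close> in the role of linear span.
  Homogeneity is transitivity of pointwise stabilisers off the span; it is the source of
  equidistribution for freshly revealed images.\<close>

locale homogeneous_action = group G for G (structure) +
  fixes V :: "'v set" and act :: "'a \<Rightarrow> 'v \<Rightarrow> 'v" and cl :: "'v set \<Rightarrow> 'v set" and q n :: nat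
  assumes finite_carrier: "finite (carrier G)"
    and finite_V: "finite V" and card_V: "card V = q ^ n"
    and q_ge_2: "q \<ge> 2"
    and act_closed: "g \<in> carrier G \<Longrightarrow> v \<in> V \<Longrightarrow> act g v \<in> V"
    and act_mult: "g \<in> carrier G \<Longrightarrow> h \<in> carrier G \<Longrightarrow> v \<in> V \<Longrightarrow> act (g \<otimes> h) v = act g (act h v)"
    and act_one: "v \<in> V \<Longrightarrow> act \<one> v = v"
    and cl_mono: "K \<subseteq> L \<Longrightarrow> cl K \<subseteq> cl L"
    and cl_extensive: "K \<subseteq> V \<Longrightarrow> K \<subseteq> cl K"
    and cl_closed: "cl K \<subseteq> V"
    and card_cl: "K \<subseteq> V \<Longrightarrow> finite K \<Longrightarrow> card (cl K) \<le> q ^ card K"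
    and cl_equivariant: "g \<in> carrier G \<Longrightarrow> K \<subseteq> V \<Longrightarrow> v \<in> cl K \<Longrightarrow> act g v \<in> cl (act g ` K)"
    and homogeneous: "K \<subseteq> V \<Longrightarrow> s \<in> V - cl K \<Longrightarrow> t \<in> V - cl K \<Longrightarrow>
      \<exists>k \<in> carrier G. (\<forall>v \<in> K. act k v = v) \<and> act k s = t"
begin

lemma finite_sub: "A \<subseteq> V \<Longrightarrow> finite A"
  using finite_V finite_subset by blast

lemma finite_cl: "finite (cl K)"
  by (simp add: cl_closed finite_sub)

lemma act_inv:
  assumes "g \<in> carrier G" "v \<in> V"
  shows "act (inv g) (act g v) = v" "act g (act (inv g) v) = v"
  using assms act_mult[of "inv g" g v] act_mult[of g "inv g" v] act_one by auto

text \<open>Equivariance under \<open>inv g\<close> supplies the converse of the axiom.\<close>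

lemma cl_equivariant_iff:
  assumes g: "g \<in> carrier G" and "K \<subseteq> V" "v \<in> V"
  shows "act g v \<in> cl (act g ` K) \<longleftrightarrow> v \<in> cl K"
proof
  assume "act g v \<in> cl (act g ` K)"
  moreover have "act g ` K \<subseteq> V"
    using assms act_closed by blast
  ultimately have "act (inv g) (act g v) \<in> cl (act (inv g) ` act g ` K)"
    using g cl_equivariant by blast
  moreover have "act (inv g) ` act g ` K = K"
    using assms act_inv by (force simp: image_iff subset_iff)
  ultimately show "v \<in> cl K"
    using assms act_inv by simp
qed (use assms cl_equivariant in blast)

section \<open>Assignments of group elements to the generators, and counting under
  constraints\<close>

abbreviation letter :: "(gen2 \<Rightarrow> 'a) \<Rightarrow> gen2 \<times> bool \<Rightarrow> 'a" where
  "letter \<rho> l \<equiv> letter_eval G (\<rho> GX) (\<rho> GY) l"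

abbreviation eval_word :: "word2 \<Rightarrow> (gen2 \<Rightarrow> 'a) \<Rightarrow> 'a" where
  "eval_word w \<rho> \<equiv> word_eval G w (\<rho> GX) (\<rho> GY)"

lemma letter_simp: "letter \<rho> l = (if snd l then inv (\<rho> (fst l)) else \<rho> (fst l))"
  by (cases "fst l"; simp add: letter_eval_def)

lemma eval_word_Cons: "eval_word (l # w) \<rho> = letter \<rho> l \<otimes> eval_word w \<rho>"
  by (simp add: word_eval_def)

text \<open>Functions rather than pairs, so that the generator beneath a letter can be updated
  without distinguishing \<open>GX\<close> from \<open>GY\<close>.\<close>

definition assignments :: "(gen2 \<Rightarrow> 'a) set" where
  "assignments = {\<rho>. \<forall>x. \<rho> x \<in> carrier G}"

lemma bij_assignments:
  "bij_betw (\<lambda>\<rho>. (\<rho> GX, \<rho> GY)) assignments (carrier G \<times> carrier G)"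
  unfolding assignments_def
  by (rule bij_betw_byWitness[where f' = "\<lambda>(g, h) x. case x of GX \<Rightarrow> g | GY \<Rightarrow> h"])
     (auto split: gen2.split)

lemma finite_assignments: "finite assignments"
  using bij_betw_finite[OF bij_assignments] finite_carrier by simp

lemma letter_closed: "\<rho> \<in> assignments \<Longrightarrow> letter \<rho> l \<in> carrier G"
  by (simp add: letter_simp assignments_def)

lemma eval_word_closed: "\<rho> \<in> assignments \<Longrightarrow> eval_word w \<rho> \<in> carrier G"
proof (induction w)
  case Nil
  then show ?case by (simp add: word_eval_def)
next
  case (Cons l w)
  then show ?case using letter_closed[of \<rho> l] by (simp add: eval_word_Cons)
qed

lemma letter_inv_letter: "\<rho> \<in> assignments \<Longrightarrow> letter \<rho> (inv_letter l) = inv (letter \<rho> l)"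
  by (simp add: letter_simp inv_letter_def assignments_def)

text \<open>A constraint \<open>(l, u, v)\<close> records that the letter \<open>l\<close> moves \<open>u\<close> to \<open>v\<close>; equivalently, that
  its inverse letter moves \<open>v\<close> to \<open>u\<close>.\<close>

definition solutions :: "((gen2 \<times> bool) \<times> 'v \<times> 'v) set \<Rightarrow> (gen2 \<Rightarrow> 'a) set" where
  "solutions C = {\<rho> \<in> assignments. \<forall>(l, u, v) \<in> C. act (letter \<rho> l) u = v}"

text \<open>The points where the value of \<open>l\<close> is prescribed. Correspondingly,
  \<open>sources (inv_letter l) C\<close> consists of the prescribed images under
  \<open>l\<close>.\<close>

definition sources :: "gen2 \<times> bool \<Rightarrow> ((gen2 \<times> bool) \<times> 'v \<times> 'v) set \<Rightarrow> 'v set" where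
  "sources l C = {u. \<exists>v. (l, u, v) \<in> C \<or> (inv_letter l, v, u) \<in> C}"

lemma finite_solutions: "finite (solutions C)"
  using finite_assignments by (simp add: solutions_def)

lemma solutions_empty: "solutions {} = assignments"
  by (simp add: solutions_def)

lemma solutions_insert:
  "solutions (insert (l, u, t) C) = {\<rho> \<in> solutions C. act (letter \<rho> l) u = t}"
  by (auto simp: solutions_def)

lemma sources_subset: "C \<subseteq> UNIV \<times> K \<times> K \<Longrightarrow> sources l C \<subseteq> K"
  by (auto simp: sources_def)

text \<open>The new constraint makes \<open>u\<close> a source of \<open>l\<close> and
  \<open>t\<close> a source of \<open>inv_letter l\<close>; the hypothesis excludes the second
  case.\<close>

lemma sources_insert:
  assumes "m \<noteq> inv_letter l"
  shows "sources m (insert (l, u, t) C) \<subseteq> insert u (sources m C)"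
  using assms by (auto simp: sources_def)

text \<open>A solution carries each prescribed point to its prescribed image, and every prescribed
  image arises so. With equivariance this compares the closures on the two sides.\<close>

lemma image_sources:
  assumes \<rho>: "\<rho> \<in> solutions C" and C: "C \<subseteq> UNIV \<times> V \<times> V"
  shows "act (letter \<rho> l) ` sources l C = sources (inv_letter l) C"
proof -
  have \<rho>': "\<rho> \<in> assignments"
    using \<rho> by (simp add: solutions_def)
  have eq: "act (letter \<rho> l) u = v" if "(l, u, v) \<in> C \<or> (inv_letter l, v, u) \<in> C" for u v
  proof (cases "(l, u, v) \<in> C")
    case True
    then show ?thesis using \<rho> by (auto simp: solutions_def)
  next
    case False
    with that have m: "(inv_letter l, v, u) \<in> C" by blast
    hence "act (letter \<rho> (inv_letter l)) v = u"
      using \<rho> by (auto simp: solutions_def)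
    moreover have "v \<in> V" using m C by auto
    ultimately show ?thesis
      using act_inv(2)[OF letter_closed[OF \<rho>'], of v l] letter_inv_letter[OF \<rho>'] by simp
  qed
  show ?thesis
    unfolding sources_def using eq by (force simp: image_iff)
qed

text \<open>Composing the value of \<open>l\<close> with \<open>k\<close> is injective on
  assignments. As \<open>k\<close> fixes the prescribed images under \<open>l\<close>, the old
  constraints survive, while the image of \<open>u\<close> moves from \<open>t\<close> to
  \<open>act k t\<close>.\<close>

lemma shift_solutions:
  assumes k: "k \<in> carrier G" "\<forall>v \<in> sources (inv_letter l) C. act k v = v"
    and C: "C \<subseteq> UNIV \<times> V \<times> V" and u: "u \<in> V"
  shows "card (solutions (insert (l, u, t) C)) \<le> card (solutions (insert (l, u, act k t) C))"
proof -
  \<comment> \<open>For an inverted letter, \<open>k\<close> on the left of the letter becomes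
    \<open>inv k\<close> on the right of the generator.\<close>
  define f where "f \<rho> = \<rho>(fst l := if snd l then \<rho> (fst l) \<otimes> inv k else k \<otimes> \<rho> (fst l))"
    for \<rho> :: "gen2 \<Rightarrow> 'a"
  have f_closed: "f \<rho> \<in> assignments" if "\<rho> \<in> assignments" for \<rho>
    using that k by (auto simp: f_def assignments_def)
  have f_l: "letter (f \<rho>) l = k \<otimes> letter \<rho> l" if "\<rho> \<in> assignments" for \<rho>
    using that k
    by (cases l; cases "fst l") (auto simp: f_def letter_eval_def assignments_def inv_mult_group)
  have f_other: "letter (f \<rho>) m = letter \<rho> m" if "m \<noteq> l" "m \<noteq> inv_letter l" for \<rho> m
  proof -
    have "fst m \<noteq> fst l"
      using that by (cases m; cases l) (auto simp: inv_letter_def)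
    thus ?thesis by (cases "fst m") (simp_all add: f_def letter_eval_def)
  qed
  have "inj_on f assignments"
  proof (rule inj_onI)
    fix \<rho> \<sigma> assume a: "\<rho> \<in> assignments" "\<sigma> \<in> assignments" "f \<rho> = f \<sigma>"
    show "\<rho> = \<sigma>"
    proof
      fix x
      have "f \<rho> x = f \<sigma> x" using a by simp
      thus "\<rho> x = \<sigma> x"
        using a k by (auto simp: f_def assignments_def split: if_splits)
    qed
  qed
  moreover have "f \<rho> \<in> solutions (insert (l, u, act k t) C)"
    if \<rho>: "\<rho> \<in> solutions (insert (l, u, t) C)" for \<rho>
  proof -
    have \<rho>a: "\<rho> \<in> assignments"
      using \<rho> by (simp add: solutions_def)
    have \<rho>C: "act (letter \<rho> m) a = b" if "(m, a, b) \<in> C" for m a b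
      using \<rho> that by (auto simp: solutions_def)
    have "act (letter (f \<rho>) m) a = b" if ab: "(m, a, b) \<in> C" for m a b
    proof -
      have V: "a \<in> V" "b \<in> V" using ab C by auto
      consider "m = l" | "m = inv_letter l" | "m \<noteq> l" "m \<noteq> inv_letter l" by blast
      thus ?thesis
      proof cases
        case 1
        hence "b \<in> sources (inv_letter l) C"
          using ab by (auto simp: sources_def)
        thus ?thesis
          using 1 \<rho>C[OF ab] f_l[OF \<rho>a] k V letter_closed[OF \<rho>a] by (simp add: act_mult)
      next
        case 2
        \<comment> \<open>A constraint on the inverse letter starts at a prescribed image under
          \<open>l\<close>, so it survives because \<open>inv k\<close> fixes that point
          too.\<close>
        have "a \<in> sources (inv_letter l) C"
          using ab 2 by (auto simp: sources_def)
        hence "act (inv k) a = a"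
          using k act_inv(1)[of k a] V by auto
        moreover have "letter (f \<rho>) m = letter \<rho> m \<otimes> inv k"
          using 2 f_l[OF \<rho>a] letter_inv_letter[OF \<rho>a] letter_inv_letter[OF f_closed[OF \<rho>a]]
            letter_closed[OF \<rho>a] k by (simp add: inv_mult_group)
        ultimately show ?thesis
          using \<rho>C[OF ab] k V letter_closed[OF \<rho>a] by (simp add: act_mult)
      next
        case 3
        thus ?thesis using f_other \<rho>C[OF ab] by simp
      qed
    qed
    moreover have "act (letter (f \<rho>) l) u = act k t"
      using \<rho> f_l k u letter_closed by (auto simp: solutions_def act_mult)
    moreover have "\<rho> \<in> assignments"
      using \<rho> by (simp add: solutions_def)
    ultimately show ?thesis
      using f_closed by (auto simp: solutions_def)
  qed
  ultimately show ?thesis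
    by (intro card_inj_on_le[where f = f])
       (auto simp: finite_solutions intro: inj_on_subset simp: solutions_def[of "insert (l, u, t) C"])
qed

text \<open>The sets counted on the left are disjoint, since an assignment determines the image of
  \<open>u\<close>.\<close>

lemma sum_card_solutions_le:
  assumes "T \<subseteq> V"
  shows "(\<Sum>t\<in>T. card (solutions (insert (l, u, t) C))) \<le> card (solutions C)"
proof -
  have "(\<Sum>t\<in>T. card (solutions (insert (l, u, t) C)))
      = card (\<Union>t\<in>T. solutions (insert (l, u, t) C))"
    using assms by (subst card_UN_disjoint) (auto simp: finite_sub finite_solutions solutions_insert)
  also have "\<dots> \<le> card (solutions C)"
    by (rule card_mono) (auto simp: finite_solutions solutions_insert)
  finally show ?thesis .
qed

text \<open>By homogeneity, every target outside the closure of the known images is hit by at least as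
  many solutions as \<open>t\<close> is.\<close>

lemma card_solutions_insert:
  assumes K: "K \<subseteq> V" and C: "C \<subseteq> UNIV \<times> K \<times> K" and u: "u \<in> V" "u \<notin> cl (sources l C)"
  shows "card (solutions (insert (l, u, t) C)) * (q ^ n - q ^ card K) \<le> card (solutions C)"
proof (cases "solutions (insert (l, u, t) C) = {}")
  case False
  then obtain \<rho> where \<rho>: "\<rho> \<in> solutions C" "act (letter \<rho> l) u = t"
    by (auto simp: solutions_insert)
  have CV: "C \<subseteq> UNIV \<times> V \<times> V"
    using K C by blast
  have \<rho>c: "letter \<rho> l \<in> carrier G"
    using \<rho> letter_closed by (simp add: solutions_def)
  let ?R = "sources (inv_letter l) C"
  have R: "?R \<subseteq> K" and S: "sources l C \<subseteq> V"
    using sources_subset[OF C] sources_subset[OF CV] by auto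
  \<comment> \<open>The solution \<rho> carries the known sources onto the known images, so a point
    outside the closure of the former lands outside the closure of the latter.\<close>
  have "t \<notin> cl ?R"
    using cl_equivariant_iff[OF \<rho>c S u(1)] u(2) image_sources[OF \<rho>(1) CV, of l] \<rho>(2) by simp
  moreover have "t \<in> V"
    using \<rho>(2) act_closed \<rho>c u(1) by blast
  ultimately have t: "t \<in> V - cl ?R" by blast
  have le: "card (solutions (insert (l, u, t) C)) \<le> card (solutions (insert (l, u, t') C))"
    if t': "t' \<in> V - cl ?R" for t'
  proof -
    obtain k where "k \<in> carrier G" "\<forall>v \<in> ?R. act k v = v" "act k t = t'"
      using homogeneous[of ?R t t'] R K t t' by auto
    thus ?thesis
      using shift_solutions[of k l C u t] CV u by auto
  qed
  have fK: "finite K" by (rule finite_sub[OF K])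
  have "card (cl ?R) \<le> q ^ card ?R"
    using card_cl[of ?R] R K fK finite_subset by blast
  also have "\<dots> \<le> q ^ card K"
    using q_ge_2 card_mono[OF fK R] by (intro power_increasing) auto
  finally have "q ^ n - q ^ card K \<le> card (V - cl ?R)"
    using card_Diff_subset[OF finite_cl cl_closed, of ?R] card_V by simp
  hence "card (solutions (insert (l, u, t) C)) * (q ^ n - q ^ card K)
      \<le> (\<Sum>t'\<in>V - cl ?R. card (solutions (insert (l, u, t) C)))"
    by (simp add: mult.commute)
  also have "\<dots> \<le> (\<Sum>t'\<in>V - cl ?R. card (solutions (insert (l, u, t') C)))"
    by (intro sum_mono le)
  also have "\<dots> \<le> card (solutions C)"
    by (rule sum_card_solutions_le) auto
  finally show ?thesis .
qed simp

section \<open>Assignments killing the word: revealing one orbit, then many\<close>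

definition trivial_solutions ::
    "word2 \<Rightarrow> ((gen2 \<times> bool) \<times> 'v \<times> 'v) set \<Rightarrow> (gen2 \<Rightarrow> 'a) set" where
  "trivial_solutions w C = {\<rho> \<in> solutions C. eval_word w \<rho> = \<one>}"

lemma finite_trivial_solutions: "finite (trivial_solutions w C)"
  using finite_solutions by (simp add: trivial_solutions_def)

text \<open>The law of total probability, conditioning on the image of \<open>u\<close> under
  \<open>l\<close>.\<close>

lemma card_trivial_solutions_split:
  assumes "u \<in> V"
  shows "card (trivial_solutions w C) = (\<Sum>t\<in>V. card (trivial_solutions w (insert (l, u, t) C)))"
proof -
  have "trivial_solutions w C = (\<Union>t\<in>V. trivial_solutions w (insert (l, u, t) C))"
    using act_closed[OF letter_closed[of _ l] assms]
    by (auto simp: trivial_solutions_def solutions_insert) (simp add: solutions_def)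
  thus ?thesis
    by (simp, subst card_UN_disjoint)
       (auto simp: finite_V finite_trivial_solutions, auto simp: trivial_solutions_def solutions_insert)
qed

text \<open>The orbit of \<open>x\<close> under the letters of \<open>w\<close>, read from the right, is revealed one point
  at a time.  As long as the new point avoids the closure of the points known so far, the next
  image is again free; if it never falls into that closure, then it does not return to \<open>x\<close>.
  After the first such coincidence the rest of the orbit is not revealed, and the bound
  \<open>\<beta>\<close> for the remaining constraints applies.\<close>

lemma card_trivial_solutions_orbit:
  fixes \<beta> :: real and d :: nat
  defines "\<epsilon> \<equiv> real (q ^ d) / real (q ^ n - q ^ d)"
  assumes "d < n" "\<beta> \<ge> 0"
    and \<beta>: "\<And>C K. K \<subseteq> V \<Longrightarrow> C \<subseteq> UNIV \<times> K \<times> K \<Longrightarrow> card K \<le> Suc d \<Longrightarrow>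
      real (card (trivial_solutions w C)) \<le> \<beta> * card (solutions C)"
    and w: "reduced w" "w \<noteq> []" "w = us @ vs"
    and K: "K \<subseteq> V" and u: "u \<in> V" "u \<notin> cl K" and C: "C \<subseteq> UNIV \<times> insert u K \<times> insert u K"
    and free: "us \<noteq> [] \<Longrightarrow> sources (last us) C \<subseteq> K"
    and x: "x \<in> V" "\<And>\<rho>. \<rho> \<in> solutions C \<Longrightarrow> act (eval_word vs \<rho>) x = u"
    and xK: "if vs = [] then x = u else x \<in> K"
    and d: "card K + length us \<le> d"
  shows "real (card (trivial_solutions w C)) \<le> real (length us) * \<epsilon> * \<beta> * card (solutions C)"
  using w K u C free x xK d
proof (induction us arbitrary: vs K u C rule: rev_induct)
  case Nil
  \<comment> \<open>All of \<open>w\<close> has been applied without a coincidence. If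
    \<open>w\<close> acts trivially then \<open>u = x\<close>, but \<open>x\<close> is in
    \<open>K\<close> as \<open>w\<close> is nonempty, whereas \<open>u\<close> lies outside
    \<open>cl K\<close>.\<close>
  have "trivial_solutions w C = {}"
  proof -
    have False if \<rho>: "\<rho> \<in> solutions C" "eval_word w \<rho> = \<one>" for \<rho>
    proof -
      have "u = x"
        using Nil.prems(3) Nil.prems(10)[OF \<rho>(1)] \<rho>(2) act_one[OF Nil.prems(9)] by simp
      thus False
        using Nil.prems(2,3,6,11) cl_extensive[OF Nil.prems(4)] by auto
    qed
    thus ?thesis by (auto simp: trivial_solutions_def)
  qed
  thus ?case by simp
next
  case (snoc l us)
  note w = snoc.prems(1,2,3) and K = snoc.prems(4) and u = snoc.prems(5,6)
    and C = snoc.prems(7) and x = snoc.prems(9,10)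
  let ?L = "insert u K"
  let ?S = "\<lambda>t. card (solutions (insert (l, u, t) C))"
  let ?T = "\<lambda>t. card (trivial_solutions w (insert (l, u, t) C))"
  have L: "?L \<subseteq> V" using K u by auto
  have fK: "finite K" by (rule finite_sub[OF K])
  have cardL: "card ?L \<le> Suc (card K)"
    by (simp add: card_insert_if fK)
  hence cardLd: "card ?L + length us \<le> d"
    using snoc.prems(12) by simp
  have src: "sources l C \<subseteq> K"
    using snoc.prems(8) by simp
  have u_free: "u \<notin> cl (sources l C)"
    using u(2) cl_mono[OF src] by auto
  have q1: "1 < real q" using q_ge_2 by simp
  have qd: "q ^ d < q ^ n"
    using \<open>d < n\<close> q_ge_2 by (intro power_strict_increasing) auto
  have \<epsilon>0: "\<epsilon> \<ge> 0" by (simp add: \<epsilon>_def)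
  \<comment> \<open>Given the constraints, each image has probability at most 1/(q^n - q^d), as
    \<open>?L\<close> has at most \<open>d\<close> points.\<close>
  have St: "real (?S t) * real (q ^ n - q ^ d) \<le> card (solutions C)" for t
  proof -
    have "q ^ card ?L \<le> q ^ d"
      using q_ge_2 cardLd by (intro power_increasing) auto
    hence "?S t * (q ^ n - q ^ d) \<le> ?S t * (q ^ n - q ^ card ?L)"
      by (intro mult_left_mono diff_le_mono2) auto
    also have "\<dots> \<le> card (solutions C)"
      by (rule card_solutions_insert[OF L C u(1) u_free])
    finally show ?thesis
      by (metis of_nat_le_iff of_nat_mult)
  qed
  \<comment> \<open>A coincidence: at most q^d targets lie in the closure, which gives the factor
    \<epsilon>, and \<beta> bounds the rest for each of them.\<close>
  have bad: "(\<Sum>t\<in>cl ?L. real (?T t)) \<le> \<epsilon> * \<beta> * card (solutions C)"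
  proof -
    have "real (?T t) \<le> \<beta> * (card (solutions C) / real (q ^ n - q ^ d))" if t: "t \<in> cl ?L" for t
    proof -
      have "real (?T t) \<le> \<beta> * ?S t"
      proof (rule \<beta>)
        show "insert t ?L \<subseteq> V" using L t cl_closed by auto
        show "insert (l, u, t) C \<subseteq> UNIV \<times> insert t ?L \<times> insert t ?L" using C by auto
        \<comment> \<open>The coincident \<open>t\<close> lies in the closure of \<open>?L\<close>
          but may be a new point, hence \<open>Suc d\<close> in the hypothesis on \<beta>.\<close>
        show "card (insert t ?L) \<le> Suc d"
          using cardLd card_insert_le_m1[of "Suc d" ?L t] by auto
      qed
      also have "\<dots> \<le> \<beta> * (card (solutions C) / real (q ^ n - q ^ d))"
        using St[of t] qd \<open>\<beta> \<ge> 0\<close>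
        by (intro mult_left_mono) (simp_all add: pos_le_divide_eq del: of_nat_diff of_nat_power)
      finally show ?thesis .
    qed
    hence "(\<Sum>t\<in>cl ?L. real (?T t)) \<le> card (cl ?L) * (\<beta> * (card (solutions C) / real (q ^ n - q ^ d)))"
      by (rule sum_bounded_above)
    also have "\<dots> \<le> real (q ^ d) * (\<beta> * (card (solutions C) / real (q ^ n - q ^ d)))"
    proof (intro mult_right_mono)
      have "card (cl ?L) \<le> q ^ card ?L"
        using card_cl[OF L] fK by simp
      also have "\<dots> \<le> q ^ d"
        using q_ge_2 cardLd by (intro power_increasing) auto
      finally show "real (card (cl ?L)) \<le> real (q ^ d)" by simp
    qed (use \<open>\<beta> \<ge> 0\<close> in simp)
    finally show ?thesis by (simp add: \<epsilon>_def)
  qed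
  \<comment> \<open>No coincidence: \<open>t\<close> becomes the current point and the remaining
    letters \<open>us\<close> are handled by induction.\<close>
  have good: "(\<Sum>t\<in>V - cl ?L. real (?T t)) \<le> length us * \<epsilon> * \<beta> * card (solutions C)"
  proof -
    have "real (?T t) \<le> length us * \<epsilon> * \<beta> * ?S t" if t: "t \<in> V - cl ?L" for t
    proof (rule snoc.IH[where vs = "l # vs" and K = ?L and u = t])
      show "reduced w" "w \<noteq> []" "w = us @ l # vs" using w by auto
      show "?L \<subseteq> V" "t \<in> V" "t \<notin> cl ?L" using L t by auto
      show "insert (l, u, t) C \<subseteq> UNIV \<times> insert t ?L \<times> insert t ?L" using C by auto
      \<comment> \<open>Reducedness enters here: the constraint just added does not prescribe the
        next letter at \<open>t\<close>.\<close>
      show "sources (last us) (insert (l, u, t) C) \<subseteq> ?L" if "us \<noteq> []"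
      proof -
        have "us = butlast us @ [last us]" using that by simp
        hence "w = butlast us @ last us # l # vs"
          using w(3) by (metis append.assoc append_Cons append_Nil)
        hence "l \<noteq> inv_letter (last us)"
          using reduced_appendD w(1) by metis
        hence "last us \<noteq> inv_letter l" by auto
        thus ?thesis
          using sources_insert[of "last us" l u t C] sources_subset[OF C, of "last us"] by auto
      qed
      show "x \<in> V" by (rule x)
      show "act (eval_word (l # vs) \<rho>) x = t" if "\<rho> \<in> solutions (insert (l, u, t) C)" for \<rho>
        using that x eval_word_closed[of \<rho> vs] letter_closed[of \<rho> l]
        by (auto simp: solutions_insert eval_word_Cons act_mult solutions_def)
      show "if l # vs = [] then x = t else x \<in> ?L"
        using snoc.prems(11) by (auto split: if_splits)
      show "card ?L + length us \<le> d" by (rule cardLd)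
    qed
    hence "(\<Sum>t\<in>V - cl ?L. real (?T t)) \<le> (\<Sum>t\<in>V - cl ?L. length us * \<epsilon> * \<beta> * ?S t)"
      by (rule sum_mono)
    also have "\<dots> = length us * \<epsilon> * \<beta> * real (\<Sum>t\<in>V - cl ?L. ?S t)"
      by (simp add: sum_distrib_left)
    also have "\<dots> \<le> length us * \<epsilon> * \<beta> * card (solutions C)"
      using sum_card_solutions_le[of "V - cl ?L" l u C] \<epsilon>0 \<open>\<beta> \<ge> 0\<close>
      by (intro mult_left_mono of_nat_mono) simp_all
    finally show ?thesis .
  qed
  have "real (card (trivial_solutions w C)) = (\<Sum>t\<in>V. real (?T t))"
    by (subst card_trivial_solutions_split[OF u(1), of w C l]) simp
  also have "\<dots> = (\<Sum>t\<in>V - cl ?L. real (?T t)) + (\<Sum>t\<in>cl ?L. real (?T t))"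
    by (rule sum.subset_diff) (auto simp: cl_closed finite_V)
  also have "\<dots> \<le> length us * \<epsilon> * \<beta> * card (solutions C) + \<epsilon> * \<beta> * card (solutions C)"
    by (rule add_mono[OF good bad])
  also have "\<dots> = length (us @ [l]) * \<epsilon> * \<beta> * card (solutions C)"
    by (simp add: distrib_right)
  finally show ?case .
qed

text \<open>A round reveals one orbit from a fresh start up to its first coincidence. It uses at
  most \<open>Suc (length w)\<close> new points and gains one factor; the induction hypothesis
  serves as the bound \<beta> for what remains.\<close>

lemma card_trivial_solutions_iterate:
  assumes d: "d < n" and w: "reduced w" "w \<noteq> []"
    and "K \<subseteq> V" "C \<subseteq> UNIV \<times> K \<times> K" "card K + i * Suc (length w) \<le> d"
  shows "real (card (trivial_solutions w C))
    \<le> (real (length w) * (real (q ^ d) / real (q ^ n - q ^ d))) ^ i * card (solutions C)"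
  using assms(4-)
proof (induction i arbitrary: K C)
  case 0
  have "card (trivial_solutions w C) \<le> card (solutions C)"
    by (rule card_mono) (auto simp: finite_solutions trivial_solutions_def)
  thus ?case by simp
next
  case (Suc i)
  note K = Suc.prems(1) and C = Suc.prems(2)
  \<comment> \<open>\<open>e\<close> bounds the known points before the coincident image is
    recorded, so the remaining rounds start from at most \<open>Suc e\<close> points.\<close>
  define e where "e = card K + length w"
  define \<epsilon> where "\<epsilon> d = real (q ^ d) / real (q ^ n - q ^ d)" for d
  define \<beta> where "\<beta> = (real (length w) * \<epsilon> d) ^ i"
  have ed: "e \<le> d" "Suc e + i * Suc (length w) \<le> d"
    using Suc.prems(3) by (simp_all add: e_def)
  have \<beta>0: "\<beta> \<ge> 0" by (simp add: \<beta>_def \<epsilon>_def)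
  \<comment> \<open>The closure has fewer than q^n elements, so a fresh starting point
    exists.\<close>
  have "card (cl K) \<le> q ^ card K"
    using card_cl[OF K finite_sub[OF K]] .
  also have "\<dots> < card V"
    unfolding card_V using q_ge_2 ed d by (intro power_strict_increasing) (auto simp: e_def)
  finally obtain u where u: "u \<in> V" "u \<notin> cl K"
    using card_mono[OF finite_cl, of V K] by (meson leD subsetI)
  have "real (card (trivial_solutions w C)) \<le> real (length w) * \<epsilon> e * \<beta> * card (solutions C)"
    unfolding \<epsilon>_def
  proof (rule card_trivial_solutions_orbit[where vs = "[]" and u = u and x = u])
    show "real (card (trivial_solutions w C')) \<le> \<beta> * card (solutions C')"
      if "K' \<subseteq> V" "C' \<subseteq> UNIV \<times> K' \<times> K'" "card K' \<le> Suc e" for C' K'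
      unfolding \<beta>_def \<epsilon>_def using that ed by (intro Suc.IH[of K']) auto
    show "sources (last w) C \<subseteq> K"
      by (rule sources_subset[OF C])
    show "act (eval_word [] \<rho>) u = u" for \<rho>
      using u by (simp add: word_eval_def act_one)
    show "C \<subseteq> UNIV \<times> insert u K \<times> insert u K"
      using C by blast
  qed (use ed d u K w \<beta>0 in \<open>simp_all add: e_def\<close>)
  \<comment> \<open>The factor for \<open>e\<close> is weakened to the one for \<open>d\<close>, so
    that all rounds share the same factor.\<close>
  also have "\<dots> \<le> real (length w) * \<epsilon> d * \<beta> * card (solutions C)"
  proof -
    have "q ^ e \<le> q ^ d"
      using q_ge_2 ed by (intro power_increasing) auto
    moreover have "q ^ d < q ^ n"
      using q_ge_2 d by (intro power_strict_increasing) auto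
    ultimately have "\<epsilon> e \<le> \<epsilon> d"
      unfolding \<epsilon>_def by (intro frac_le of_nat_mono diff_le_mono2) (simp_all del: of_nat_diff)
    thus ?thesis
      using \<beta>0 by (intro mult_right_mono mult_left_mono) auto
  qed
  finally show ?case
    by (simp add: \<beta>_def \<epsilon>_def mult_ac)
qed

theorem word_measure_one_le:
  assumes "reduced w" "w \<noteq> []" "i * Suc (length w) \<le> d" "d < n"
  shows "word_measure w G \<one> \<le> (real (length w) * (real (q ^ d) / real (q ^ n - q ^ d))) ^ i"
proof -
  let ?B = "{(g, h). g \<in> carrier G \<and> h \<in> carrier G \<and> word_eval G w g h = \<one>}"
  let ?f = "\<lambda>\<rho>. (\<rho> GX, \<rho> GY) :: 'a \<times> 'a"
  have "bij_betw ?f (trivial_solutions w {}) (?f ` trivial_solutions w {})"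
    by (rule bij_betw_subset[OF bij_assignments])
       (auto simp: trivial_solutions_def solutions_empty)
  moreover have "?f ` trivial_solutions w {} = ?B"
  proof
    show "?f ` trivial_solutions w {} \<subseteq> ?B"
      by (auto simp: trivial_solutions_def solutions_empty assignments_def)
    show "?B \<subseteq> ?f ` trivial_solutions w {}"
    proof clarify
      fix g h assume gh: "g \<in> carrier G" "h \<in> carrier G" "word_eval G w g h = \<one>"
      hence "case_gen2 g h \<in> trivial_solutions w {}"
        by (auto simp: trivial_solutions_def solutions_empty assignments_def split: gen2.split)
      thus "(g, h) \<in> ?f ` trivial_solutions w {}"
        by (rule rev_image_eqI) simp
    qed
  qed
  ultimately have "card ?B = card (trivial_solutions w {})"
    by (simp add: bij_betw_same_card)
  also have "real \<dots> \<le> (real (length w) * (real (q ^ d) / real (q ^ n - q ^ d))) ^ i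
      * card (solutions {})"
    using assms by (intro card_trivial_solutions_iterate[of d w "{}"]) auto
  also have "card (solutions {}) = card (carrier G) ^ 2"
    using bij_betw_same_card[OF bij_assignments]
    by (simp add: solutions_empty card_cartesian_product power2_eq_square)
  finally have "real (card ?B) \<le> (real (length w) * (real (q ^ d) / real (q ^ n - q ^ d))) ^ i
      * real (card (carrier G)) ^ 2"
    by simp
  moreover have "card (carrier G) > 0"
    using finite_carrier one_closed card_gt_0_iff by blast
  ultimately show ?thesis
    unfolding word_measure_def by (simp add: pos_divide_le_eq)
qed

end

section \<open>Vectors and matrices over a finite field, the group GL_n, and linear spans\<close>

lemma card_carrier_vec: "card (carrier_vec n :: 'k::finite vec set) = CARD('k) ^ n"
proof -
  have "bij_betw list_of_vec (carrier_vec n :: 'k vec set) {xs. set xs \<subseteq> UNIV \<and> length xs = n}"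
    by (rule bij_betw_byWitness[where f' = vec_of_list]) (auto simp: list_vec vec_list intro: carrier_vecI)
  thus ?thesis
    using card_lists_length_eq[of "UNIV :: 'k set" n] by (simp add: bij_betw_same_card)
qed

lemma finite_carrier_vec: "finite (carrier_vec n :: 'k::finite vec set)"
  by (rule card_ge_0_finite) (simp add: card_carrier_vec)

lemma finite_carrier_mat_card:
  shows "finite (carrier_mat m n :: 'k::finite mat set)"
    and "card (carrier_mat m n :: 'k mat set) \<le> CARD('k) ^ (m * n)"
proof -
  let ?I = "{..<m} \<times> {..<n}" and ?M = "carrier_mat m n :: 'k mat set"
  let ?f = "\<lambda>A. restrict (($$) A) ?I"
  have inj: "inj_on ?f ?M"
  proof (rule inj_onI)
    fix A B :: "'k mat"
    assume AB: "A \<in> ?M" "B \<in> ?M" "?f A = ?f B"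
    show "A = B"
    proof (rule eq_matI)
      fix i j assume "i < dim_row B" "j < dim_col B"
      moreover have "?f A (i, j) = ?f B (i, j)" by (simp only: AB(3))
      ultimately show "A $$ (i, j) = B $$ (i, j)"
        using AB(2) by simp
    qed (use AB in auto)
  qed
  have sub: "?f ` ?M \<subseteq> ?I \<rightarrow>\<^sub>E UNIV" by (auto split: if_splits)
  have fin: "finite (?I \<rightarrow>\<^sub>E (UNIV :: 'k set))" by (simp add: finite_PiE)
  show "finite ?M"
    using finite_imageD[OF finite_subset[OF sub fin] inj] .
  show "card ?M \<le> CARD('k) ^ (m * n)"
    using card_inj_on_le[OF inj sub fin] by (simp add: card_PiE card_cartesian_product)
qed

lemma group_GL: "group (GL n :: 'k::field mat monoid)"
proof (rule groupI)
  fix A :: "'k mat" assume "A \<in> carrier (GL n)"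
  hence A: "A \<in> carrier_mat n n" "det A \<noteq> 0" by (auto simp: GL_def)
  obtain B where B: "B \<in> carrier_mat n n" "B * A = 1\<^sub>m n"
    using det_non_zero_imp_unit[OF A, of "()"] by (auto simp: Units_def ring_mat_def)
  hence "det B * det A = 1"
    using det_mult[OF B(1) A(1)] by simp
  thus "\<exists>B \<in> carrier (GL n). B \<otimes>\<^bsub>GL n\<^esub> A = \<one>\<^bsub>GL n\<^esub>"
    using B by (intro bexI[of _ B]) (auto simp: GL_def)
qed (auto simp: GL_def det_mult)

text \<open>The linear span of \<open>K\<close>, described as a double annihilator: separating functionals then
  come for free and no basis is needed.\<close>

definition biannihilator :: "nat \<Rightarrow> 'k::field vec set \<Rightarrow> 'k vec set" where
  "biannihilator n K = {t \<in> carrier_vec n.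
     \<forall>\<phi> \<in> carrier_vec n. (\<forall>v \<in> K. \<phi> \<bullet> v = 0) \<longrightarrow> \<phi> \<bullet> t = 0}"

text \<open>Adjoining a vector raises the dimension by at most one. The parametrisation by a scalar
  and an old element yields the factor \<open>CARD('k)\<close> in the count.\<close>

lemma biannihilator_insert:
  fixes a :: "'k::field vec"
  assumes K: "K \<subseteq> carrier_vec n" and a: "a \<in> carrier_vec n"
  shows "biannihilator n (insert a K)
    \<subseteq> (\<lambda>(c, s). s + c \<cdot>\<^sub>v a) ` (UNIV \<times> biannihilator n K)"
proof
  fix t assume t: "t \<in> biannihilator n (insert a K)"
  hence tn: "t \<in> carrier_vec n" by (simp add: biannihilator_def)
  have t0: "\<phi> \<bullet> t = 0" if "\<phi> \<in> carrier_vec n" "\<phi> \<bullet> a = 0" "\<forall>v\<in>K. \<phi> \<bullet> v = 0" for \<phi>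
    using t that by (simp add: biannihilator_def)
  show "t \<in> (\<lambda>(c, s). s + c \<cdot>\<^sub>v a) ` (UNIV \<times> biannihilator n K)"
  proof (cases "\<exists>\<phi> \<in> carrier_vec n. (\<forall>v\<in>K. \<phi> \<bullet> v = 0) \<and> \<phi> \<bullet> a \<noteq> 0")
    case False
    hence "t \<in> biannihilator n K"
      using t0 tn by (auto simp: biannihilator_def)
    moreover have "t = t + 0 \<cdot>\<^sub>v a" using tn a by auto
    ultimately show ?thesis by (intro image_eqI[of _ _ "(0, t)"]) simp_all
  next
    case True
    then obtain \<phi> where \<phi>: "\<phi> \<in> carrier_vec n" "\<forall>v\<in>K. \<phi> \<bullet> v = 0" "\<phi> \<bullet> a \<noteq> 0" by blast
    \<comment> \<open>This choice makes \<phi> vanish on \<open>s\<close>, which is \<open>t\<close>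
      minus \<open>c\<close> times \<open>a\<close>.\<close>
    define c where "c = (\<phi> \<bullet> t) / (\<phi> \<bullet> a)"
    define s where "s = t + (- c) \<cdot>\<^sub>v a"
    have sn: "s \<in> carrier_vec n" using tn a by (simp add: s_def)
    have "\<psi> \<bullet> s = 0" if \<psi>: "\<psi> \<in> carrier_vec n" "\<forall>v\<in>K. \<psi> \<bullet> v = 0" for \<psi>
    proof -
      \<comment> \<open>Correcting \<psi> by a multiple of \<phi> makes it kill \<open>a\<close> as
        well as \<open>K\<close>, hence also \<open>t\<close>; and \<chi>(t) equals
        \<psi>(s).\<close>
      define \<chi> where "\<chi> = \<psi> + (- (\<psi> \<bullet> a) / (\<phi> \<bullet> a)) \<cdot>\<^sub>v \<phi>"
      have \<chi>: "\<chi> \<bullet> v = \<psi> \<bullet> v - (\<psi> \<bullet> a) / (\<phi> \<bullet> a) * (\<phi> \<bullet> v)" if "v \<in> carrier_vec n" for v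
        using that \<psi> \<phi> by (simp add: \<chi>_def add_scalar_prod_distrib[of _ n])
      have "\<chi> \<bullet> t = 0"
      proof (rule t0)
        show "\<chi> \<in> carrier_vec n" using \<psi> \<phi> by (simp add: \<chi>_def)
        show "\<chi> \<bullet> a = 0" using \<chi>[OF a] \<phi> by simp
        show "\<forall>v\<in>K. \<chi> \<bullet> v = 0" using \<chi> \<psi> \<phi> K by auto
      qed
      thus "\<psi> \<bullet> s = 0"
        using \<chi>[OF tn] \<psi> tn a by (simp add: s_def c_def scalar_prod_add_distrib[of _ n])
    qed
    hence "s \<in> biannihilator n K"
      using sn by (simp add: biannihilator_def)
    moreover have "t = s + c \<cdot>\<^sub>v a"
      using tn a by (intro eq_vecI) (auto simp: s_def)
    ultimately show ?thesis by (intro image_eqI[of _ _ "(c, s)"]) simp_all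
  qed
qed

lemma biannihilator_empty: "biannihilator n {} = {0\<^sub>v n :: 'k::field vec}"
proof -
  have "t = 0\<^sub>v n" if t: "t \<in> biannihilator n {}" for t :: "'k vec"
  proof (rule eq_vecI)
    have tn: "t \<in> carrier_vec n" using t by (simp add: biannihilator_def)
    show "dim_vec t = dim_vec (0\<^sub>v n)" using tn by simp
    fix i assume "i < dim_vec (0\<^sub>v n :: 'k vec)"
    hence i: "i < n" by simp
    have "unit_vec n i \<bullet> t = 0" using t by (simp add: biannihilator_def)
    thus "t $ i = 0\<^sub>v n $ i" using i tn by (simp add: scalar_prod_left_unit)
  qed
  thus ?thesis by (auto simp: biannihilator_def)
qed

lemma card_biannihilator:
  fixes K :: "'k::{field,finite} vec set"
  assumes "finite K" "K \<subseteq> carrier_vec n"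
  shows "card (biannihilator n K) \<le> CARD('k) ^ card K"
  using assms
proof (induction K rule: finite_induct)
  case empty
  then show ?case by (simp add: biannihilator_empty)
next
  case (insert a K)
  have fin: "finite (biannihilator n K)"
    by (rule finite_subset[OF _ finite_carrier_vec]) (auto simp: biannihilator_def)
  have "card (biannihilator n (insert a K))
      \<le> card ((\<lambda>(c, s). s + c \<cdot>\<^sub>v a) ` ((UNIV :: 'k set) \<times> biannihilator n K))"
    using insert.prems fin by (intro card_mono biannihilator_insert) auto
  also have "\<dots> \<le> card ((UNIV :: 'k set) \<times> biannihilator n K)"
    by (rule card_image_le) (simp add: fin)
  also have "\<dots> \<le> CARD('k) ^ card (insert a K)"
    using insert by (simp add: card_cartesian_product)
  finally show ?case .
qed

text \<open>A functional that kills the image of \<open>K\<close> pulls back along the transpose to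
  one that kills \<open>K\<close>.\<close>

lemma biannihilator_mult_mat_vec:
  fixes A :: "'k::field mat"
  assumes A: "A \<in> carrier_mat n n" and K: "K \<subseteq> carrier_vec n" and v: "v \<in> biannihilator n K"
  shows "A *\<^sub>v v \<in> biannihilator n ((*\<^sub>v) A ` K)"
proof -
  have vn: "v \<in> carrier_vec n" using v by (simp add: biannihilator_def)
  have "\<phi> \<bullet> (A *\<^sub>v v) = 0"
    if \<phi>: "\<phi> \<in> carrier_vec n" "\<forall>u \<in> (*\<^sub>v) A ` K. \<phi> \<bullet> u = 0" for \<phi>
  proof -
    have eq: "\<phi> \<bullet> (A *\<^sub>v u) = (A\<^sup>T *\<^sub>v \<phi>) \<bullet> u" if "u \<in> carrier_vec n" for u
      using transpose_vec_mult_scalar[OF A that \<phi>(1)] by simp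
    have "\<forall>u\<in>K. (A\<^sup>T *\<^sub>v \<phi>) \<bullet> u = 0"
      using \<phi>(2) K by (auto simp flip: eq)
    moreover have "A\<^sup>T *\<^sub>v \<phi> \<in> carrier_vec n" using A \<phi> by simp
    ultimately show ?thesis
      using v eq[OF vn] by (simp add: biannihilator_def)
  qed
  thus ?thesis using A vn by (simp add: biannihilator_def)
qed

text \<open>The annihilator of \<open>K\<close> is not the union of two proper subspaces, here the
  functionals killing \<open>s\<close> and those killing \<open>t\<close>.\<close>

lemma ex_functional_nonzero_both:
  fixes s t :: "'k::field vec"
  assumes "s \<in> carrier_vec n - biannihilator n K" "t \<in> carrier_vec n - biannihilator n K"
    and K: "K \<subseteq> carrier_vec n"
  obtains \<phi> where "\<phi> \<in> carrier_vec n" "\<forall>v\<in>K. \<phi> \<bullet> v = 0" "\<phi> \<bullet> s \<noteq> 0" "\<phi> \<bullet> t \<noteq> 0"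
proof -
  obtain \<phi> where \<phi>: "\<phi> \<in> carrier_vec n" "\<forall>v\<in>K. \<phi> \<bullet> v = 0" "\<phi> \<bullet> s \<noteq> 0"
    using assms by (auto simp: biannihilator_def)
  obtain \<psi> where \<psi>: "\<psi> \<in> carrier_vec n" "\<forall>v\<in>K. \<psi> \<bullet> v = 0" "\<psi> \<bullet> t \<noteq> 0"
    using assms by (auto simp: biannihilator_def)
  have add: "(\<phi> + \<psi>) \<bullet> v = \<phi> \<bullet> v + \<psi> \<bullet> v" if "v \<in> carrier_vec n" for v
    using that \<phi> \<psi> by (simp add: add_scalar_prod_distrib[of _ n])
  show thesis
  proof (cases "\<phi> \<bullet> t \<noteq> 0 \<or> \<psi> \<bullet> s \<noteq> 0")
    case True
    thus ?thesis using that \<phi> \<psi> by blast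
  next
    \<comment> \<open>Each functional kills the vector that the other one detects, so their sum
      detects both.\<close>
    case False
    show ?thesis
    proof (rule that)
      show "\<phi> + \<psi> \<in> carrier_vec n" using \<phi> \<psi> by simp
      show "\<forall>v\<in>K. (\<phi> + \<psi>) \<bullet> v = 0" using add \<phi> \<psi> K by auto
      show "(\<phi> + \<psi>) \<bullet> s \<noteq> 0" "(\<phi> + \<psi>) \<bullet> t \<noteq> 0"
        using False add assms \<phi> \<psi> by auto
    qed
  qed
qed

text \<open>The witness is the rank-one perturbation \<open>v \<mapsto> v + \<phi>(v) (t - s)\<close> of the identity, where
  \<open>\<phi>\<close> vanishes on \<open>K\<close> and \<open>\<phi>(s) = 1\<close>; it is injective because \<open>\<phi>(t) \<noteq> 0\<close>.\<close>

lemma GL_homogeneous: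
  fixes s t :: "'k::field vec"
  assumes s: "s \<in> carrier_vec n - biannihilator n K" and t: "t \<in> carrier_vec n - biannihilator n K"
    and K: "K \<subseteq> carrier_vec n"
  shows "\<exists>A \<in> carrier (GL n). (\<forall>v\<in>K. A *\<^sub>v v = v) \<and> A *\<^sub>v s = t"
proof -
  obtain \<psi> where \<psi>: "\<psi> \<in> carrier_vec n" "\<forall>v\<in>K. \<psi> \<bullet> v = 0" "\<psi> \<bullet> s \<noteq> 0" "\<psi> \<bullet> t \<noteq> 0"
    using ex_functional_nonzero_both[OF s t K] .
  define \<phi> where "\<phi> = (1 / (\<psi> \<bullet> s)) \<cdot>\<^sub>v \<psi>"
  have sn: "s \<in> carrier_vec n" and tn: "t \<in> carrier_vec n" using s t by auto
  have \<phi>n: "\<phi> \<in> carrier_vec n" using \<psi> by (simp add: \<phi>_def)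
  have \<phi>v: "\<phi> \<bullet> v = (\<psi> \<bullet> v) / (\<psi> \<bullet> s)" if "v \<in> carrier_vec n" for v
    using that \<psi> by (simp add: \<phi>_def)
  have \<phi>s: "\<phi> \<bullet> s = 1" and \<phi>t: "\<phi> \<bullet> t \<noteq> 0"
    using \<phi>v sn tn \<psi> by auto
  have \<phi>K: "\<forall>v\<in>K. \<phi> \<bullet> v = 0" using \<phi>v \<psi> K by auto
  define A where "A = 1\<^sub>m n + mat n n (\<lambda>(i, j). (t - s) $ i * \<phi> $ j)"
  have An: "A \<in> carrier_mat n n" by (simp add: A_def)
  have Av: "A *\<^sub>v v = v + (\<phi> \<bullet> v) \<cdot>\<^sub>v (t - s)" if v: "v \<in> carrier_vec n" for v
  proof -
    have "mat n n (\<lambda>(i, j). (t - s) $ i * \<phi> $ j) *\<^sub>v v = (\<phi> \<bullet> v) \<cdot>\<^sub>v (t - s)"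
    proof (rule eq_vecI)
      fix i assume "i < dim_vec ((\<phi> \<bullet> v) \<cdot>\<^sub>v (t - s))"
      hence "i < n" using sn by simp
      thus "(mat n n (\<lambda>(i, j). (t - s) $ i * \<phi> $ j) *\<^sub>v v) $ i = ((\<phi> \<bullet> v) \<cdot>\<^sub>v (t - s)) $ i"
        using v sn tn \<phi>n by (simp add: scalar_prod_def sum_distrib_left mult_ac)
    qed (use sn in simp)
    thus ?thesis
      using v by (simp add: A_def add_mult_distrib_mat_vec[of _ n n])
  qed
  have fixed: "A *\<^sub>v v = v" if "v \<in> carrier_vec n" "\<phi> \<bullet> v = 0" for v
    using Av[OF that(1)] that sn tn by (intro eq_vecI) auto
  have "det A \<noteq> 0"
  proof
    assume "det A = 0"
    then obtain v where v: "v \<in> carrier_vec n" "v \<noteq> 0\<^sub>v n" "A *\<^sub>v v = 0\<^sub>v n"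
      using det_0_iff_vec_prod_zero[OF An] by blast
    \<comment> \<open>Since \<phi>(t - s) = \<phi>(t) - 1, a kernel vector \<open>v\<close> has
      \<phi>(v) = 0; then \<open>A\<close> fixes \<open>v\<close>, so \<open>v\<close> is
      zero.\<close>
    have "\<phi> \<bullet> (A *\<^sub>v v) = \<phi> \<bullet> v * (\<phi> \<bullet> t)"
      unfolding Av[OF v(1)] using v(1) sn tn \<phi>n \<phi>s
      by (simp add: scalar_prod_add_distrib[of _ n] scalar_prod_minus_distrib[of _ n] algebra_simps)
    hence "\<phi> \<bullet> v = 0" using v(3) \<phi>n \<phi>t by simp
    thus False using fixed v by simp
  qed
  moreover have "A *\<^sub>v s = t"
    using Av[OF sn] \<phi>s sn tn by (intro eq_vecI) auto
  moreover have "\<forall>v\<in>K. A *\<^sub>v v = v"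
    using fixed \<phi>K K by blast
  ultimately show ?thesis using An by (auto simp: GL_def)
qed

section \<open>GL_n on column vectors as an instance of the abstract action\<close>

lemma one_less_card_field: "1 < CARD('k::{field,finite})"
proof -
  have "card {0, 1 :: 'k} \<le> CARD('k)" by (rule card_mono) auto
  thus ?thesis by simp
qed

lemma homogeneous_action_GL:
  "homogeneous_action (GL n :: 'k::{field,finite} mat monoid) (carrier_vec n) (*\<^sub>v)
     (biannihilator n) CARD('k) n"
proof (rule homogeneous_action.intro[OF group_GL], unfold_locales)
  show "finite (carrier (GL n :: 'k mat monoid))"
    by (rule finite_subset[OF _ finite_carrier_mat_card(1)[of n n]]) (auto simp: GL_def)
  show "K \<subseteq> biannihilator n K" if "K \<subseteq> carrier_vec n" for K :: "'k vec set"
    using that by (auto simp: biannihilator_def)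
  show "A *\<^sub>v v \<in> biannihilator n ((*\<^sub>v) A ` K)"
    if "A \<in> carrier (GL n)" "K \<subseteq> carrier_vec n" "v \<in> biannihilator n K" for A :: "'k mat" and K v
    using that by (intro biannihilator_mult_mat_vec) (auto simp: GL_def)
  show "2 \<le> CARD('k)"
    using one_less_card_field[where 'k = 'k] by simp
  show "\<exists>A \<in> carrier (GL n). (\<forall>v\<in>K. A *\<^sub>v v = v) \<and> A *\<^sub>v s = t"
    if "K \<subseteq> carrier_vec n" "s \<in> carrier_vec n - biannihilator n K"
      "t \<in> carrier_vec n - biannihilator n K" for K :: "'k vec set" and s t
    using that by (intro GL_homogeneous)
  show "card (biannihilator n K) \<le> CARD('k) ^ card K"
    if "K \<subseteq> carrier_vec n" "finite K" for K :: "'k vec set"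
    using that by (intro card_biannihilator)
  show "biannihilator n K \<subseteq> biannihilator n L" if "K \<subseteq> L" for K L :: "'k vec set"
    using that unfolding biannihilator_def by blast
  show "biannihilator n K \<subseteq> carrier_vec n" for K :: "'k vec set"
    unfolding biannihilator_def by blast
  show "A *\<^sub>v v \<in> carrier_vec n"
    if "A \<in> carrier (GL n)" "v \<in> carrier_vec n" for A :: "'k mat" and v
    using that mult_mat_vec_carrier[of A n n v] by (simp add: GL_def)
  show "(A \<otimes>\<^bsub>GL n\<^esub> B) *\<^sub>v v = A *\<^sub>v (B *\<^sub>v v)"
    if "A \<in> carrier (GL n)" "B \<in> carrier (GL n)" "v \<in> carrier_vec n" for A B :: "'k mat" and v
    using that assoc_mult_mat_vec[of A n n B n v] by (simp add: GL_def)
  show "\<one>\<^bsub>GL n\<^esub> *\<^sub>v v = v" if "v \<in> carrier_vec n" for v :: "'k vec"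
    using that by (simp add: GL_def)
qed (rule finite_carrier_vec card_carrier_vec)+

lemma card_GL_le: "card (carrier (GL n :: 'k::{field,finite} mat monoid)) \<le> CARD('k) ^ (n * n)"
proof -
  have "card (carrier (GL n :: 'k mat monoid)) \<le> card (carrier_mat n n :: 'k mat set)"
    by (rule card_mono[OF finite_carrier_mat_card(1)]) (auto simp: GL_def)
  also note finite_carrier_mat_card(2)
  finally show ?thesis .
qed

section \<open>Numerical estimates and the bound for GL_n\<close>

lemma double_le_power: "1 \<le> l \<Longrightarrow> 2 * l \<le> (2::nat) ^ l"
proof (induction l rule: dec_induct)
  case (step l)
  thus ?case by (cases l) auto
qed simp

text \<open>As q^d is at most half of q^n, the denominator costs a factor 2. Then 2l \<le> 2^l \<le>
  q^l absorbs the prefactor and leaves the exponent l + d - n.\<close>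

lemma orbit_factor_le:
  fixes q n l d :: nat
  assumes q: "q \<ge> 2" and l: "l \<ge> 1" and d: "2 * (d + l) \<le> n"
  shows "real l * (real (q ^ d) / real (q ^ n - q ^ d)) \<le> real q powr (- (real n / 2))"
proof -
  have "2 * q ^ d \<le> q ^ Suc d" using q by simp
  also have "\<dots> \<le> q ^ n" using q l d by (intro power_increasing) auto
  finally have "2 * q ^ d \<le> q ^ n" .
  hence half: "real q ^ n / 2 \<le> real (q ^ n - q ^ d)"
    by (simp add: field_simps flip: of_nat_power)
  have "2 * l \<le> 2 ^ l" by (rule double_le_power[OF l])
  also have "\<dots> \<le> q ^ l" using q by (intro power_mono) auto
  finally have lq: "2 * real l \<le> real q ^ l"
    by (metis of_nat_le_iff of_nat_mult of_nat_numeral of_nat_power)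
  have q0: "real q > 0" using q by simp
  have "real l * (real (q ^ d) / real (q ^ n - q ^ d)) \<le> real l * (real q ^ d / (real q ^ n / 2))"
    using half q0 by (intro mult_left_mono frac_le) auto
  also have "\<dots> = 2 * real l * (real q ^ d / real q ^ n)" by simp
  also have "\<dots> \<le> real q ^ l * (real q ^ d / real q ^ n)"
    using lq by (intro mult_right_mono) auto
  also have "\<dots> = real q powr (real l + real d - real n)"
    using q0 by (simp add: powr_add powr_diff powr_realpow)
  also have "\<dots> \<le> real q powr (- (real n / 2))"
    using q d by (intro powr_mono) auto
  finally show ?thesis .
qed

text \<open>With m the quotient, the claim amounts to 2n \<le> 11lm. Rounding gives 4lm \<ge> n -
  6l, and 6l \<le> 3n/16 by the threshold 32l, so 64lm \<ge> 13n; finally 11 * 13 > 2 * 64.\<close>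

lemma exponent_bound:
  fixes l n :: nat
  assumes l: "l \<ge> 1" and n: "n \<ge> 32 * l"
  shows "real (n * n) / (11 * real l) \<le> real n / 2 * real ((n - 2 * l) div (4 * l))"
proof -
  define m where "m = (n - 2 * l) div (4 * l)"
  have "n - 2 * l = 4 * l * m + (n - 2 * l) mod (4 * l)"
    by (simp add: m_def)
  moreover have "(n - 2 * l) mod (4 * l) < 4 * l" using l by simp
  ultimately have "n \<le> 4 * l * m + 6 * l" using n by linarith
  hence "real n \<le> real (4 * l * m + 6 * l)" by (simp only: of_nat_le_iff)
  moreover have "real n \<ge> 32 * real l" using n by linarith
  ultimately have "2 * real n \<le> 11 * (real l * real m)" by simp
  hence "real n * (2 * real n) \<le> real n * (11 * (real l * real m))"
    by (rule mult_left_mono) simp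
  thus ?thesis
    unfolding m_def[symmetric] using l by (simp add: field_simps)
qed

theorem theorem3p12:
  fixes w :: word2 and n p :: nat
  assumes "reduced w" and "w \<noteq> []"
    and "n \<ge> 32 * length w"
    and "prime p" and "card (UNIV :: ('k::{field,finite}) set) = p"
  shows "word_measure w (GL n :: 'k mat monoid) (\<one>\<^bsub>GL n :: 'k mat monoid\<^esub>)
         \<le> real (card (carrier (GL n :: 'k mat monoid))) powr (- 1 / (11 * real (length w)))"
proof -
  interpret homogeneous_action "GL n :: 'k mat monoid" "carrier_vec n" "(*\<^sub>v)"
    "biannihilator n" "CARD('k)" n
    by (rule homogeneous_action_GL)
  \<comment> \<open>\<open>m\<close> is the number of orbits to reveal, with
    \<open>2 * l * m\<close> known points allowed because each orbit costs l + 1 \<le> 2l. The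
    condition 2(2lm + l) \<le> n of \<open>orbit_factor_le\<close> dictates the quotient.\<close>
  define q l m where "q = CARD('k)" and "l = length w" and "m = (n - 2 * l) div (4 * l)"
  have l: "l \<ge> 1" and n: "n \<ge> 32 * l" and q: "q \<ge> 2"
    using assms q_ge_2 by (simp_all add: l_def Suc_le_eq q_def)
  have "4 * l * m \<le> n - 2 * l"
    by (simp add: m_def)
  hence d: "2 * (2 * l * m + l) \<le> n" using n by simp
  let ?G = "GL n :: 'k mat monoid"
  have "word_measure w ?G \<one>\<^bsub>?G\<^esub>
      \<le> (real l * (real (q ^ (2 * l * m)) / real (q ^ n - q ^ (2 * l * m)))) ^ m"
    unfolding q_def l_def
  proof (rule word_measure_one_le)
    have "m * Suc l \<le> m * (2 * l)" using l by (intro mult_left_mono) auto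
    thus "m * Suc (length w) \<le> 2 * length w * m" by (simp add: l_def mult_ac)
    show "2 * length w * m < n" using d l by (simp add: l_def)
  qed (use assms in auto)
  also have "\<dots> \<le> (real q powr (- (real n / 2))) ^ m"
    by (intro power_mono orbit_factor_le q l d) simp
  also have "\<dots> = real q powr (- (real n / 2 * real m))"
    using q by (simp add: powr_power mult.commute)
  also have "\<dots> \<le> real q powr (- (real (n * n) / (11 * real l)))"
    using exponent_bound[OF l n] q by (intro powr_mono) (auto simp: m_def)
  also have "\<dots> = real (q ^ (n * n)) powr (- 1 / (11 * real l))"
    using q by (simp add: powr_powr flip: powr_realpow)
  \<comment> \<open>The exponent is negative, so an upper bound on the group order gives a lower
    bound on its power.\<close>
  also have "\<dots> \<le> real (card (carrier ?G)) powr (- 1 / (11 * real l))"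
  proof (rule powr_mono2')
    show "0 < real (card (carrier ?G))"
      using finite_carrier one_closed card_gt_0_iff by fastforce
    show "real (card (carrier ?G)) \<le> real (q ^ (n * n))"
      using card_GL_le[where 'k = 'k and n = n] by (simp add: q_def flip: of_nat_power)
  qed simp
  finally show ?thesis by (simp add: l_def)
qed

end
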